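(* Let $(\mathcal{H},m,u,\Delta,\varepsilon,S)$ be a connected filtered Hopf algebra over a field $k$ of characteristic zero, with reduced coproduct $\widetilde{\Delta}(x)=\Delta(x)-1\otimes x-x\otimes 1$ for $x\in\ker\varepsilon$. Let $N\subseteq\mathcal{H}$ be a linear subspace with $\varepsilon(N)=\{0\}$ and $\widetilde{\Delta}(N)\subseteq N\otimes\mathcal{H}$. Let $\mathcal{A}$ be a commutative unital $k$-algebra, let $G_{\mathcal{A}}$ be the group of unital algebra morphisms $\mathcal{H}\to\mathcal{A}$ under the convolution product $\phi\star\psi=m_{\mathcal{A}}\circ(\phi\otimes\psi)\circ\Delta$, and let $T_{\mathcal{A}}:=\{\phi\in G_{\mathcal{A}}:\phi|_N=0\}$ (a subgroup of $G_{\mathcal{A}}$). Let $\zeta:N\to\mathcal{A}$ be a linear map such that $\zeta(vw)=\zeta(v)\zeta(w)$ whenever $v$, $w$ and the product $vw$ all belong to $N$, and set $$X_{\mathcal{A},\zeta}:=\{\alpha\in G_{\mathcal{A}}:\ \alpha|_N=\zeta\}.$$ Then $(\phi,\alpha)\mapsto\phi\star\alpha$ defines a left action of $T_{\mathcal{A}}$ on $X_{\mathcal{A},\zeta}$, and this action is free and transitive.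
   Context: The unit of $G_{\mathcal{A}}$ is $e=u_{\mathcal{A}}\circ\varepsilon$ and the inverse of $\phi$ is $\phi\circ S$. *)

theory Defs
  imports HOL.Vector_Spaces "HOL-Library.Poly_Mapping" "HOL-Algebra.Group_Action"
begin

section \<open>Tensor products of vector spaces\<close>

text \<open>
  \<open>V \<otimes> W\<close> is the quotient of the free vector space on \<open>V \<times> W\<close> by the subspace generated by
  the bilinearity relations. Since the relations depend on the scalar multiplications \<open>sV\<close>, \<open>sW\<close>,
  which are terms, an element of \<open>V \<otimes> W\<close> is represented as a coset (a set of formal linear
  combinations) and not as an element of a quotient type.
\<close>

definition free_scale :: "'k::field \<Rightarrow> ('b \<Rightarrow>\<^sub>0 'k) \<Rightarrow> ('b \<Rightarrow>\<^sub>0 'k)" where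
  "free_scale c p = Poly_Mapping.map ((*) c) p"

definition free_extend ::
  "('k::field \<Rightarrow> 'u::ab_group_add \<Rightarrow> 'u) \<Rightarrow> ('b \<Rightarrow> 'u) \<Rightarrow> ('b \<Rightarrow>\<^sub>0 'k) \<Rightarrow> 'u" where
  "free_extend sU f p = (\<Sum>b\<in>Poly_Mapping.keys p. sU (Poly_Mapping.lookup p b) (f b))"

definition formal :: "'b \<Rightarrow> ('b \<Rightarrow>\<^sub>0 'k::field)" where
  "formal b = Poly_Mapping.single b 1"

type_synonym ('k, 'v, 'w) tensor = "(('v \<times> 'w) \<Rightarrow>\<^sub>0 'k) set"

context
  fixes sV :: "'k::field \<Rightarrow> 'v::ab_group_add \<Rightarrow> 'v"
    and sW :: "'k \<Rightarrow> 'w::ab_group_add \<Rightarrow> 'w"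
begin

definition tensor_relations :: "(('v \<times> 'w) \<Rightarrow>\<^sub>0 'k) set" where
  "tensor_relations =
     {formal (x + x', y) - formal (x, y) - formal (x', y) | x x' y. True}
   \<union> {formal (x, y + y') - formal (x, y) - formal (x, y') | x y y'. True}
   \<union> {formal (sV c x, y) - free_scale c (formal (x, y)) | c x y. True}
   \<union> {formal (x, sW c y) - free_scale c (formal (x, y)) | c x y. True}"

definition tensor_null :: "(('v \<times> 'w) \<Rightarrow>\<^sub>0 'k) set" where
  "tensor_null = module.span free_scale tensor_relations"

definition tensor_class :: "(('v \<times> 'w) \<Rightarrow>\<^sub>0 'k) \<Rightarrow> ('k, 'v, 'w) tensor" where
  "tensor_class p = {q. q - p \<in> tensor_null}"

definition tensor_space :: "('k, 'v, 'w) tensor set" where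
  "tensor_space = range tensor_class"

definition pure :: "'v \<Rightarrow> 'w \<Rightarrow> ('k, 'v, 'w) tensor" where
  "pure x y = tensor_class (formal (x, y))"

end

text \<open>
  All operations below are computed on a chosen representative. This is only meaningful, and only
  used, for maps that respect the bilinearity relations, where the choice is irrelevant.
\<close>

definition tensor_rep :: "('k::field, 'v, 'w) tensor \<Rightarrow> (('v \<times> 'w) \<Rightarrow>\<^sub>0 'k)" where
  "tensor_rep t = (SOME p. p \<in> t)"

definition tensor_lift ::
  "('k::field \<Rightarrow> 'u::ab_group_add \<Rightarrow> 'u) \<Rightarrow> ('v \<Rightarrow> 'w \<Rightarrow> 'u) \<Rightarrow> ('k, 'v, 'w) tensor \<Rightarrow> 'u" where
  "tensor_lift sU b t = free_extend sU (\<lambda>(x, y). b x y) (tensor_rep t)"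

definition tensor_map ::
  "('k::field \<Rightarrow> 'v'::ab_group_add \<Rightarrow> 'v') \<Rightarrow> ('k \<Rightarrow> 'w'::ab_group_add \<Rightarrow> 'w') \<Rightarrow>
   ('v \<Rightarrow> 'v') \<Rightarrow> ('w \<Rightarrow> 'w') \<Rightarrow> ('k, 'v, 'w) tensor \<Rightarrow> ('k, 'v', 'w') tensor" where
  "tensor_map sV' sW' f g t =
     tensor_class sV' sW' (free_extend free_scale (\<lambda>(x, y). formal (f x, g y)) (tensor_rep t))"

context
  fixes sV :: "'k::field \<Rightarrow> 'v::ab_group_add \<Rightarrow> 'v"
    and sW :: "'k \<Rightarrow> 'w::ab_group_add \<Rightarrow> 'w"
begin

definition tensor_add ::
  "('k, 'v, 'w) tensor \<Rightarrow> ('k, 'v, 'w) tensor \<Rightarrow> ('k, 'v, 'w) tensor" where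
  "tensor_add s t = tensor_class sV sW (tensor_rep s + tensor_rep t)"

definition tensor_diff ::
  "('k, 'v, 'w) tensor \<Rightarrow> ('k, 'v, 'w) tensor \<Rightarrow> ('k, 'v, 'w) tensor" where
  "tensor_diff s t = tensor_class sV sW (tensor_rep s - tensor_rep t)"

definition tensor_scale :: "'k \<Rightarrow> ('k, 'v, 'w) tensor \<Rightarrow> ('k, 'v, 'w) tensor" where
  "tensor_scale c t = tensor_class sV sW (free_scale c (tensor_rep t))"

text \<open>
  The subspace of \<open>V \<otimes> W\<close> spanned by the \<open>x \<otimes> y\<close> with \<open>(x, y) \<in> P\<close>. For subspaces \<open>V'\<close>, \<open>W'\<close>
  and \<open>P = V' \<times> W'\<close> this is (the image of) \<open>V' \<otimes> W'\<close>.
\<close>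

definition tensors_on :: "('v \<times> 'w) set \<Rightarrow> ('k, 'v, 'w) tensor set" where
  "tensors_on P = tensor_class sV sW ` {p. Poly_Mapping.keys p \<subseteq> P}"

end

text \<open>The triple tensor product \<open>V \<otimes> V \<otimes> V\<close>, by the same construction.\<close>

context
  fixes s :: "'k::field \<Rightarrow> 'v::ab_group_add \<Rightarrow> 'v"
begin

definition tensor3_relations :: "(('v \<times> 'v \<times> 'v) \<Rightarrow>\<^sub>0 'k) set" where
  "tensor3_relations =
     {formal (x + x', y, z) - formal (x, y, z) - formal (x', y, z) | x x' y z. True}
   \<union> {formal (x, y + y', z) - formal (x, y, z) - formal (x, y', z) | x y y' z. True}
   \<union> {formal (x, y, z + z') - formal (x, y, z) - formal (x, y, z') | x y z z'. True}
   \<union> {formal (s c x, y, z) - free_scale c (formal (x, y, z)) | c x y z. True}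
   \<union> {formal (x, s c y, z) - free_scale c (formal (x, y, z)) | c x y z. True}
   \<union> {formal (x, y, s c z) - free_scale c (formal (x, y, z)) | c x y z. True}"

definition tensor3_class :: "(('v \<times> 'v \<times> 'v) \<Rightarrow>\<^sub>0 'k) \<Rightarrow> (('v \<times> 'v \<times> 'v) \<Rightarrow>\<^sub>0 'k) set" where
  "tensor3_class p = {q. q - p \<in> module.span free_scale tensor3_relations}"

text \<open>\<open>D \<otimes> id\<close> and \<open>id \<otimes> D\<close> as maps \<open>V \<otimes> V \<rightarrow> V \<otimes> V \<otimes> V\<close>, for \<open>D : V \<rightarrow> V \<otimes> V\<close>\<close>

definition comul_left ::
  "('v \<Rightarrow> ('k, 'v, 'v) tensor) \<Rightarrow> ('k, 'v, 'v) tensor \<Rightarrow> (('v \<times> 'v \<times> 'v) \<Rightarrow>\<^sub>0 'k) set" where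
  "comul_left D t = tensor3_class (free_extend free_scale
     (\<lambda>(x, z). free_extend free_scale (\<lambda>(a, b). formal (a, b, z)) (tensor_rep (D x)))
     (tensor_rep t))"

definition comul_right ::
  "('v \<Rightarrow> ('k, 'v, 'v) tensor) \<Rightarrow> ('k, 'v, 'v) tensor \<Rightarrow> (('v \<times> 'v \<times> 'v) \<Rightarrow>\<^sub>0 'k) set" where
  "comul_right D t = tensor3_class (free_extend free_scale
     (\<lambda>(x, y). free_extend free_scale (\<lambda>(a, b). formal (x, a, b)) (tensor_rep (D y)))
     (tensor_rep t))"

end

lemma lookup_free_scale [simp]:
  "Poly_Mapping.lookup (free_scale c p) b = c * Poly_Mapping.lookup p b"
  by (simp add: free_scale_def Poly_Mapping.map.rep_eq when_def)

lemma vector_space_free_scale: "vector_space (free_scale :: 'k::field \<Rightarrow> ('b \<Rightarrow>\<^sub>0 'k) \<Rightarrow> _)"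
  by unfold_locales (auto intro!: poly_mapping_eqI simp: lookup_add algebra_simps)

lemma tensor_rep_class:
  fixes sV :: "'k::field \<Rightarrow> 'v::ab_group_add \<Rightarrow> 'v" and sW :: "'k \<Rightarrow> 'w::ab_group_add \<Rightarrow> 'w"
  shows "tensor_rep (tensor_class sV sW p) - p \<in> tensor_null sV sW"
proof -
  interpret vector_space "free_scale :: 'k \<Rightarrow> ('v \<times> 'w \<Rightarrow>\<^sub>0 'k) \<Rightarrow> _"
    by (rule vector_space_free_scale)
  have "p \<in> tensor_class sV sW p"
    by (simp add: tensor_class_def tensor_null_def span_zero)
  then have "tensor_rep (tensor_class sV sW p) \<in> tensor_class sV sW p"
    unfolding tensor_rep_def by (rule someI)
  then show ?thesis by (simp add: tensor_class_def)
qed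

lemma module_hom_free_extend:
  fixes sU :: "'k::field \<Rightarrow> 'u::ab_group_add \<Rightarrow> 'u" and f :: "'b \<Rightarrow> 'u"
  assumes "vector_space sU"
  shows "module_hom free_scale sU (free_extend sU f)"
proof -
  interpret F: vector_space "free_scale :: 'k \<Rightarrow> ('b \<Rightarrow>\<^sub>0 'k) \<Rightarrow> _"
    by (rule vector_space_free_scale)
  interpret U: vector_space sU by fact
  have ext: "free_extend sU f p = (\<Sum>b\<in>S. sU (Poly_Mapping.lookup p b) (f b))"
    if "finite S" "Poly_Mapping.keys p \<subseteq> S" for S p
    unfolding free_extend_def using that
    by (intro sum.mono_neutral_left) (auto simp: in_keys_iff)
  show ?thesis
  proof unfold_locales
    fix p q :: "'b \<Rightarrow>\<^sub>0 'k"
    let ?S = "Poly_Mapping.keys p \<union> Poly_Mapping.keys q"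
    show "free_extend sU f (p + q) = free_extend sU f p + free_extend sU f q"
      using ext[of ?S "p + q"] ext[of ?S p] ext[of ?S q] Poly_Mapping.keys_add[of p q]
      by (simp add: lookup_add U.scale_left_distrib sum.distrib)
  next
    fix c and p :: "'b \<Rightarrow>\<^sub>0 'k"
    have "Poly_Mapping.keys (free_scale c p) \<subseteq> Poly_Mapping.keys p"
      by (auto simp: in_keys_iff)
    then show "free_extend sU f (free_scale c p) = sU c (free_extend sU f p)"
      using ext[of "Poly_Mapping.keys p" "free_scale c p"] ext[of "Poly_Mapping.keys p" p]
      by (simp add: U.scale_sum_right)
  qed
qed

lemma free_extend_formal:
  assumes "vector_space sU"
  shows "free_extend sU f (formal b) = f b"
proof -
  interpret U: vector_space sU by fact
  show ?thesis by (simp add: free_extend_def formal_def)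
qed

text \<open>A bilinear map induces a map on the tensor product, independently of representatives.\<close>

lemma tensor_lift_class:
  assumes U: "vector_space sU"
    and add: "\<And>x x' y. b (x + x') y = b x y + b x' y" "\<And>x y y'. b x (y + y') = b x y + b x y'"
    and scale: "\<And>c x y. b (sV c x) y = sU c (b x y)" "\<And>c x y. b x (sW c y) = sU c (b x y)"
  shows "tensor_lift sU b (tensor_class sV sW p) = free_extend sU (\<lambda>(x, y). b x y) p"
proof -
  interpret L: module_hom free_scale sU "free_extend sU (\<lambda>(x, y). b x y)"
    by (rule module_hom_free_extend[OF U])
  have "free_extend sU (\<lambda>(x, y). b x y) q = 0" if "q \<in> tensor_null sV sW" for q
    using that unfolding tensor_null_def
  proof (rule L.eq_0_on_span[rotated])
    fix r assume "r \<in> tensor_relations sV sW"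
    then show "free_extend sU (\<lambda>(x, y). b x y) r = 0"
      unfolding tensor_relations_def
      by (auto simp: L.diff L.scale free_extend_formal[OF U] add scale)
  qed
  from this[OF tensor_rep_class] show ?thesis
    by (simp add: tensor_lift_def L.diff)
qed


section \<open>Algebras, Hopf algebras, characters\<close>

text \<open>
  Associative unital algebras. The sort does not include \<open>0 \<noteq> 1\<close>, so the zero algebra is allowed.
\<close>

locale k_algebra = vector_space scale
  for scale :: "'k::field \<Rightarrow> 'a::{ring, monoid_mult} \<Rightarrow> 'a" +
  assumes scale_mult_left: "scale c x * y = scale c (x * y)"
    and scale_mult_right: "x * scale c y = scale c (x * y)"

definition mult_map ::
  "('k::field \<Rightarrow> 'a::{ring, monoid_mult} \<Rightarrow> 'a) \<Rightarrow> ('k, 'a, 'a) tensor \<Rightarrow> 'a" where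
  "mult_map s = tensor_lift s (*)"

definition alg_hom ::
  "('k::field \<Rightarrow> 'a::{ring, monoid_mult} \<Rightarrow> 'a) \<Rightarrow> ('k \<Rightarrow> 'b::{ring, monoid_mult} \<Rightarrow> 'b) \<Rightarrow>
   ('a \<Rightarrow> 'b) set" where
  "alg_hom sA sB =
     {f. Vector_Spaces.linear sA sB f \<and> f 1 = 1 \<and> (\<forall>x y. f (x * y) = f x * f y)}"

text \<open>\<open>(x \<otimes> y)(x' \<otimes> y') = xx' \<otimes> yy'\<close>\<close>

definition tensor_mult ::
  "('k::field \<Rightarrow> 'a::{ring, monoid_mult} \<Rightarrow> 'a) \<Rightarrow>
   ('k, 'a, 'a) tensor \<Rightarrow> ('k, 'a, 'a) tensor \<Rightarrow> ('k, 'a, 'a) tensor" where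
  "tensor_mult sA t t' = tensor_class sA sA (free_extend free_scale
     (\<lambda>(x, y). free_extend free_scale (\<lambda>(x', y'). formal (x * x', y * y')) (tensor_rep t'))
     (tensor_rep t))"

locale hopf_algebra = k_algebra sH
  for sH :: "'k::field \<Rightarrow> 'h::{ring, monoid_mult} \<Rightarrow> 'h" +
  fixes \<Delta> :: "'h \<Rightarrow> ('k, 'h, 'h) tensor"
    and \<epsilon> :: "'h \<Rightarrow> 'k"
    and S :: "'h \<Rightarrow> 'h"
  assumes comul_in: "\<Delta> x \<in> tensor_space sH sH"
    and comul_add: "\<Delta> (x + y) = tensor_add sH sH (\<Delta> x) (\<Delta> y)"
    and comul_scale: "\<Delta> (sH c x) = tensor_scale sH sH c (\<Delta> x)"
    and comul_one: "\<Delta> 1 = pure sH sH 1 1"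
    and comul_mult: "\<Delta> (x * y) = tensor_mult sH (\<Delta> x) (\<Delta> y)"
    and counit_alg_hom: "\<epsilon> \<in> alg_hom sH (*)"
    and coassoc: "comul_left sH \<Delta> (\<Delta> x) = comul_right sH \<Delta> (\<Delta> x)"
    and counit_left: "tensor_lift sH (\<lambda>x y. sH (\<epsilon> x) y) (\<Delta> z) = z"
    and counit_right: "tensor_lift sH (\<lambda>x y. sH (\<epsilon> y) x) (\<Delta> z) = z"
    and antipode_linear: "Vector_Spaces.linear sH sH S"
    and antipode_left: "mult_map sH (tensor_map sH sH S id (\<Delta> x)) = sH (\<epsilon> x) 1"
    and antipode_right: "mult_map sH (tensor_map sH sH id S (\<Delta> x)) = sH (\<epsilon> x) 1"

text \<open>
  \<open>F n\<close> is the \<open>n\<close>-th step of the filtration. The right-hand side of \<open>filt_comul\<close> is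
  \<open>\<Sum>p+q=n. F p \<otimes> F q\<close>.
\<close>

locale connected_filtered_hopf_algebra = hopf_algebra sH \<Delta> \<epsilon> S
  for sH :: "'k::field \<Rightarrow> 'h::{ring, monoid_mult} \<Rightarrow> 'h"
    and \<Delta> :: "'h \<Rightarrow> ('k, 'h, 'h) tensor"
    and \<epsilon> :: "'h \<Rightarrow> 'k"
    and S :: "'h \<Rightarrow> 'h" +
  fixes F :: "nat \<Rightarrow> 'h set"
  assumes filt_subspace: "subspace (F n)"
    and filt_mono: "F n \<subseteq> F (Suc n)"
    and filt_exhaustive: "(\<Union>n. F n) = UNIV"
    and filt_one: "1 \<in> F 0"
    and filt_mult: "x \<in> F p \<Longrightarrow> y \<in> F q \<Longrightarrow> x * y \<in> F (p + q)"
    and filt_comul: "x \<in> F n \<Longrightarrow> \<Delta> x \<in> tensors_on sH sH (\<Union>p\<le>n. F p \<times> F (n - p))"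
    and filt_antipode: "x \<in> F n \<Longrightarrow> S x \<in> F n"
    and connected: "dim (F 0) = 1"

definition reduced_comul ::
  "('k::field \<Rightarrow> 'h::{ring, monoid_mult} \<Rightarrow> 'h) \<Rightarrow> ('h \<Rightarrow> ('k, 'h, 'h) tensor) \<Rightarrow>
   'h \<Rightarrow> ('k, 'h, 'h) tensor" where
  "reduced_comul sH \<Delta> x =
     tensor_diff sH sH (tensor_diff sH sH (\<Delta> x) (pure sH sH 1 x)) (pure sH sH x 1)"

definition convolution ::
  "('k::field \<Rightarrow> 'a::{ring, monoid_mult} \<Rightarrow> 'a) \<Rightarrow> ('h \<Rightarrow> ('k, 'h, 'h) tensor) \<Rightarrow>
   ('h \<Rightarrow> 'a) \<Rightarrow> ('h \<Rightarrow> 'a) \<Rightarrow> 'h \<Rightarrow> 'a" where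
  "convolution sA \<Delta> \<phi> \<psi> x = mult_map sA (tensor_map sA sA \<phi> \<psi> (\<Delta> x))"

definition character_group ::
  "('k::field \<Rightarrow> 'h::{ring, monoid_mult} \<Rightarrow> 'h) \<Rightarrow> ('h \<Rightarrow> ('k, 'h, 'h) tensor) \<Rightarrow> ('h \<Rightarrow> 'k) \<Rightarrow>
   ('k \<Rightarrow> 'a::{comm_ring, monoid_mult} \<Rightarrow> 'a) \<Rightarrow> ('h \<Rightarrow> 'a) monoid" where
  "character_group sH \<Delta> \<epsilon> sA =
     \<lparr>carrier = alg_hom sH sA, mult = convolution sA \<Delta>, one = (\<lambda>x. sA (\<epsilon> x) 1)\<rparr>"

definition vanishing_characters ::
  "('k::field \<Rightarrow> 'h::{ring, monoid_mult} \<Rightarrow> 'h) \<Rightarrow>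
   ('k \<Rightarrow> 'a::{comm_ring, monoid_mult} \<Rightarrow> 'a) \<Rightarrow> 'h set \<Rightarrow> ('h \<Rightarrow> 'a) set" where
  "vanishing_characters sH sA N = {\<phi> \<in> alg_hom sH sA. \<forall>w\<in>N. \<phi> w = 0}"

definition extending_characters ::
  "('k::field \<Rightarrow> 'h::{ring, monoid_mult} \<Rightarrow> 'h) \<Rightarrow>
   ('k \<Rightarrow> 'a::{comm_ring, monoid_mult} \<Rightarrow> 'a) \<Rightarrow> 'h set \<Rightarrow> ('h \<Rightarrow> 'a) \<Rightarrow> ('h \<Rightarrow> 'a) set" where
  "extending_characters sH sA N \<zeta> = {\<alpha> \<in> alg_hom sH sA. \<forall>w\<in>N. \<alpha> w = \<zeta> w}"

end

theory Submission
  imports Defs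
begin

text \<open>
  On \<open>N\<close> the value of \<open>f \<star> g\<close> is \<open>f(w) + g(w) + \<Sum> f(w') g(w'')\<close> with all \<open>w'\<close> in \<open>N\<close>, so it depends
  on \<open>f\<close> only through \<open>f|\<^sub>N\<close>. If \<open>\<phi>\<close> vanishes on \<open>N\<close> it agrees there with the unit, hence
  \<open>\<phi> \<star> \<alpha> = \<alpha>\<close> on \<open>N\<close>. If \<open>\<alpha>\<close> and \<open>\<beta>\<close> agree on \<open>N\<close>, then \<open>\<beta> \<star> \<alpha>\<^sup>-\<^sup>1\<close> agrees there with
  \<open>\<alpha> \<star> \<alpha>\<^sup>-\<^sup>1 = e\<close>, i.e. vanishes, and it maps \<open>\<alpha>\<close> to \<open>\<beta>\<close>.
\<close>

section \<open>Linear maps out of tensor products\<close>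

text \<open>Bilinearity is phrased as linearity in each slot, so that closure rules for linear maps
  can prove it.\<close>

definition bilinear_map ::
  "('k::field \<Rightarrow> 'v::ab_group_add \<Rightarrow> 'v) \<Rightarrow> ('k \<Rightarrow> 'w::ab_group_add \<Rightarrow> 'w) \<Rightarrow>
   ('k \<Rightarrow> 'u::ab_group_add \<Rightarrow> 'u) \<Rightarrow> ('v \<Rightarrow> 'w \<Rightarrow> 'u) \<Rightarrow> bool" where
  "bilinear_map sV sW sU b \<longleftrightarrow>
     (\<forall>y. Vector_Spaces.linear sV sU (\<lambda>x. b x y)) \<and> (\<forall>x. Vector_Spaces.linear sW sU (b x))"

lemma bilinear_mapI:
  assumes "\<And>y. Vector_Spaces.linear sV sU (\<lambda>x. b x y)" "\<And>x. Vector_Spaces.linear sW sU (\<lambda>y. b x y)"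
  shows "bilinear_map sV sW sU b"
  using assms by (simp add: bilinear_map_def)

lemma module_hom_free_extend_distrib:
  assumes "module_hom sU sW L"
  shows "L (free_extend sU g p) = free_extend sW (\<lambda>b. L (g b)) p"
proof -
  interpret module_hom sU sW L by fact
  show ?thesis by (simp add: free_extend_def sum scale)
qed

lemma free_extend_cong:
  "(\<And>b. b \<in> Poly_Mapping.keys p \<Longrightarrow> f b = g b) \<Longrightarrow> free_extend sU f p = free_extend sU g p"
  by (simp add: free_extend_def)

lemma tensor_lift_bilinear:
  assumes b: "bilinear_map sV sW sU b" and U: "vector_space sU"
  shows "tensor_lift sU b (tensor_class sV sW p) = free_extend sU (\<lambda>(x, y). b x y) p"
  using b by (intro tensor_lift_class[OF U])
    (auto simp: bilinear_map_def Vector_Spaces.linear_iff)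

lemma tensor_lift_pure:
  assumes b: "bilinear_map sV sW sU b" and U: "vector_space sU"
  shows "tensor_lift sU b (pure sV sW x y) = b x y"
  by (simp add: pure_def tensor_lift_bilinear[OF b U] free_extend_formal[OF U])

text \<open>\<open>tensor_add\<close> works on chosen representatives;
  \<open>tensor_lift_bilinear\<close> evaluates the resulting class, and linearity of
  \<open>free_extend\<close> does the rest. Differences and multiples go the same way.\<close>

lemma tensor_lift_add:
  assumes b: "bilinear_map sV sW sU b" and U: "vector_space sU"
  shows "tensor_lift sU b (tensor_add sV sW s t) = tensor_lift sU b s + tensor_lift sU b t"
  by (simp add: tensor_add_def tensor_lift_bilinear[OF b U])
    (simp add: tensor_lift_def module_hom.add[OF module_hom_free_extend[OF U]])

lemma tensor_lift_diff:
  assumes b: "bilinear_map sV sW sU b" and U: "vector_space sU"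
  shows "tensor_lift sU b (tensor_diff sV sW s t) = tensor_lift sU b s - tensor_lift sU b t"
  by (simp add: tensor_diff_def tensor_lift_bilinear[OF b U])
    (simp add: tensor_lift_def module_hom.diff[OF module_hom_free_extend[OF U]])

lemma tensor_lift_scale:
  assumes b: "bilinear_map sV sW sU b" and U: "vector_space sU"
  shows "tensor_lift sU b (tensor_scale sV sW c t) = sU c (tensor_lift sU b t)"
  by (simp add: tensor_scale_def tensor_lift_bilinear[OF b U])
    (simp add: tensor_lift_def module_hom.scale[OF module_hom_free_extend[OF U]])

text \<open>Both sides are computed from the same representative of \<open>t\<close>; bilinearity of
  \<open>b\<close> evaluates the class formed by \<open>tensor_map\<close>.\<close>

lemma tensor_lift_tensor_map:
  assumes b: "bilinear_map sV sW sU b" and U: "vector_space sU"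
  shows "tensor_lift sU b (tensor_map sV sW f g t) = tensor_lift sU (\<lambda>x y. b (f x) (g y)) t"
  unfolding tensor_map_def tensor_lift_bilinear[OF b U]
  by (simp add: tensor_lift_def case_prod_unfold
      module_hom_free_extend_distrib[OF module_hom_free_extend[OF U]] free_extend_formal[OF U])

lemma linear_tensor_lift_distrib:
  assumes "Vector_Spaces.linear sU sW f"
  shows "f (tensor_lift sU b t) = tensor_lift sW (\<lambda>x y. f (b x y)) t"
proof -
  interpret Vector_Spaces.linear sU sW f by fact
  show ?thesis
    by (simp add: tensor_lift_def case_prod_unfold
        module_hom_free_extend_distrib[OF module_hom_axioms])
qed

lemma linear_tensor_lift_param:
  assumes t: "\<And>a b. Vector_Spaces.linear sV sU (\<lambda>z. f z a b)"
    and V: "vector_space sV" and U: "vector_space sU"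
  shows "Vector_Spaces.linear sV sU (\<lambda>z. tensor_lift sU (f z) s)"
proof -
  interpret V: vector_space sV by fact
  interpret U: vector_space sU by fact
  from t have "f (x + y) a b = f x a b + f y a b" "f (sV c x) a b = sU c (f x a b)" for x y a b c
    by (auto simp: Vector_Spaces.linear_iff)
  then show ?thesis
    using V U by (simp add: Vector_Spaces.linear_iff tensor_lift_def free_extend_def case_prod_unfold
        U.scale_right_distrib sum.distrib U.scale_sum_right mult.commute)
qed

text \<open>With the representatives fixed, both sides are finite double sums, so the order of
  summation can be exchanged.\<close>

lemma tensor_lift_swap:
  assumes U: "vector_space sU"
  shows "tensor_lift sU (\<lambda>a b. tensor_lift sU (\<lambda>c d. f a b c d) t) s =
    tensor_lift sU (\<lambda>c d. tensor_lift sU (\<lambda>a b. f a b c d) s) t"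
proof -
  interpret U: vector_space sU by fact
  show ?thesis
    unfolding tensor_lift_def free_extend_def case_prod_unfold
    by (simp add: U.scale_sum_right) (subst sum.swap, simp add: mult.commute)
qed

text \<open>A trilinear map kills the relations of the triple tensor product, hence descends to it.
  This turns coassociativity into an identity between values of trilinear maps.\<close>

lemma free_extend_tensor3_class:
  fixes s :: "'k::field \<Rightarrow> 'v::ab_group_add \<Rightarrow> 'v"
  assumes lin: "\<And>y z. Vector_Spaces.linear s sU (\<lambda>x. t x y z)"
    "\<And>x z. Vector_Spaces.linear s sU (\<lambda>y. t x y z)"
    "\<And>x y. Vector_Spaces.linear s sU (\<lambda>z. t x y z)"
    and U: "vector_space sU"
    and eq: "tensor3_class s p = tensor3_class s q"
  shows "free_extend sU (\<lambda>(x, y, z). t x y z) p = free_extend sU (\<lambda>(x, y, z). t x y z) q"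
proof -
  interpret F: vector_space "free_scale :: 'k \<Rightarrow> ('v \<times> 'v \<times> 'v \<Rightarrow>\<^sub>0 'k) \<Rightarrow> _"
    by (rule vector_space_free_scale)
  interpret L: module_hom free_scale sU "free_extend sU (\<lambda>(x, y, z). t x y z)"
    by (rule module_hom_free_extend[OF U])
  have "p \<in> tensor3_class s p"
    by (simp add: tensor3_class_def F.span_zero)
  then have "p - q \<in> F.span (tensor3_relations s)"
    by (simp add: eq) (simp add: tensor3_class_def)
  then have "free_extend sU (\<lambda>(x, y, z). t x y z) (p - q) = 0"
  proof (rule L.eq_0_on_span[rotated])
    fix r assume "r \<in> tensor3_relations s"
    with lin show "free_extend sU (\<lambda>(x, y, z). t x y z) r = 0"
      unfolding tensor3_relations_def
      by (auto simp: L.diff L.scale free_extend_formal[OF U] Vector_Spaces.linear_iff)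
  qed
  then show ?thesis by (simp add: L.diff)
qed


section \<open>The group of characters\<close>

locale hopf_characters = hopf_algebra sH \<Delta> \<epsilon> S + A: k_algebra sA
  for sH :: "'k::field \<Rightarrow> 'h::{ring, monoid_mult} \<Rightarrow> 'h"
    and \<Delta> :: "'h \<Rightarrow> ('k, 'h, 'h) tensor"
    and \<epsilon> :: "'h \<Rightarrow> 'k"
    and S :: "'h \<Rightarrow> 'h"
    and sA :: "'k \<Rightarrow> 'a::{comm_ring, monoid_mult} \<Rightarrow> 'a"
begin

abbreviation lin :: "('h \<Rightarrow> 'a) \<Rightarrow> bool" where
  "lin \<equiv> Vector_Spaces.linear sH sA"

abbreviation bilin :: "('h \<Rightarrow> 'h \<Rightarrow> 'a) \<Rightarrow> bool" where
  "bilin \<equiv> bilinear_map sH sH sA"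

text \<open>In Sweedler notation, \<open>D b x = \<Sum> b x\<^sub>1 x\<^sub>2\<close>.\<close>

abbreviation D :: "('h \<Rightarrow> 'h \<Rightarrow> 'a) \<Rightarrow> 'h \<Rightarrow> 'a" where
  "D b x \<equiv> tensor_lift sA b (\<Delta> x)"

section \<open>Calculus of Sweedler sums\<close>

lemma vsH: "vector_space sH" and vsA: "vector_space sA"
  by unfold_locales

lemma linI: "(\<And>x y. f (x + y) = f x + f y) \<Longrightarrow> (\<And>c x. f (sH c x) = sA c (f x)) \<Longrightarrow> lin f"
  by (simp add: Vector_Spaces.linear_iff vsH vsA)

lemma lin_add: "lin f \<Longrightarrow> f (x + y) = f x + f y"
  and lin_scale: "lin f \<Longrightarrow> f (sH c x) = sA c (f x)"
  by (simp_all add: Vector_Spaces.linear_iff)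

lemma counit: "\<epsilon> (x + y) = \<epsilon> x + \<epsilon> y" "\<epsilon> (sH c x) = c * \<epsilon> x" "\<epsilon> 1 = 1" "\<epsilon> (x * y) = \<epsilon> x * \<epsilon> y"
  using counit_alg_hom by (auto simp: alg_hom_def Vector_Spaces.linear_iff)

lemma scale_one_mult: "sA c 1 * x = sA c x" "x * sA c 1 = sA c x"
  by (simp_all add: A.scale_mult_left A.scale_mult_right)

lemma lin_mult_const: "lin f \<Longrightarrow> lin (\<lambda>x. f x * c)"
  and lin_const_mult: "lin f \<Longrightarrow> lin (\<lambda>x. c * f x)"
  by (auto intro!: linI simp: lin_add lin_scale algebra_simps A.scale_mult_left A.scale_mult_right)

lemma lin_arg_mult: "lin f \<Longrightarrow> lin (\<lambda>x. f (x * c))"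
  and lin_mult_arg: "lin f \<Longrightarrow> lin (\<lambda>x. f (c * x))"
  by (auto intro!: linI simp: lin_add lin_scale distrib_left distrib_right
      scale_mult_left scale_mult_right)

lemma lin_counit: "lin (\<lambda>x. sA (\<epsilon> x) c)"
  by (rule linI) (simp_all add: counit A.scale_left_distrib)

lemma lin_antipode: "lin f \<Longrightarrow> lin (\<lambda>x. f (S x))"
  using Vector_Spaces.linear_compose[OF antipode_linear] by (simp add: comp_def)

text \<open>Here the variable sits in the summand while the tensor is fixed; in \<open>lin_D\<close>
  it sits under \<open>\<Delta>\<close>, where linearity of \<open>\<Delta>\<close> and bilinearity
  of the summand enter.\<close>

lemma lin_D_param: "(\<And>a b. lin (\<lambda>z. f z a b)) \<Longrightarrow> lin (\<lambda>z. D (f z) x)"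
  by (rule linear_tensor_lift_param[OF _ vsH vsA])

lemma lin_D:
  assumes "\<And>y. lin (\<lambda>x. b x y)" "\<And>x. lin (\<lambda>y. b x y)"
  shows "lin (\<lambda>x. D (\<lambda>u v. b u v) x)"
  using bilinear_mapI[OF assms] by (auto intro!: linI simp: comul_add comul_scale
      tensor_lift_add[OF _ vsA] tensor_lift_scale[OF _ vsA])

lemmas lin_intros = lin_mult_const lin_const_mult lin_counit lin_D_param lin_D

text \<open>Multiplication by \<open>c\<close> is linear on the target. Read from left to right, the
  rules push factors inwards, so that products of sums become nested sums of products.\<close>

lemma D_const_mult: "c * D b x = D (\<lambda>u v. c * b u v) x"
  and D_mult_const: "D b x * c = D (\<lambda>u v. b u v * c) x"
proof -
  have "Vector_Spaces.linear sA sA (\<lambda>x. c * x)" "Vector_Spaces.linear sA sA (\<lambda>x. x * c)"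
    by (simp_all add: Vector_Spaces.linear_iff vsA algebra_simps A.scale_mult_left A.scale_mult_right)
  from this[THEN linear_tensor_lift_distrib, of b "\<Delta> x"]
  show "c * D b x = D (\<lambda>u v. c * b u v) x" "D b x * c = D (\<lambda>u v. b u v * c) x"
    by auto
qed

lemma D_one: "bilin b \<Longrightarrow> D b 1 = b 1 1"
  by (simp add: comul_one tensor_lift_pure[OF _ vsA])

lemma D_counit_left: "lin f \<Longrightarrow> D (\<lambda>x y. sA (\<epsilon> x) (f y)) z = f z"
  using linear_tensor_lift_distrib[of sH sA f "\<lambda>x y. sH (\<epsilon> x) y" "\<Delta> z"]
  by (simp add: counit_left lin_scale)

lemma D_counit_right: "lin f \<Longrightarrow> D (\<lambda>x y. sA (\<epsilon> y) (f x)) z = f z"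
  using linear_tensor_lift_distrib[of sH sA f "\<lambda>x y. sH (\<epsilon> y) x" "\<Delta> z"]
  by (simp add: counit_right lin_scale)

lemma D_mult:
  assumes "bilin b"
  shows "D b (x * y) = D (\<lambda>u v. D (\<lambda>u' v'. b (u * u') (v * v')) y) x"
  unfolding comul_mult tensor_mult_def tensor_lift_bilinear[OF assms vsA]
  by (simp add: tensor_lift_def case_prod_unfold free_extend_formal[OF vsA]
      module_hom_free_extend_distrib[OF module_hom_free_extend[OF vsA]])

text \<open>Coassociativity tested against a trilinear map: both sides sum \<open>t\<close> over the
  iterated coproduct of \<open>w\<close>.\<close>

lemma D_coassoc:
  assumes "\<And>y z. lin (\<lambda>x. t x y z)" "\<And>x z. lin (\<lambda>y. t x y z)" "\<And>x y. lin (\<lambda>z. t x y z)"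
  shows "D (\<lambda>u z. D (\<lambda>x y. t x y z) u) w = D (\<lambda>x v. D (\<lambda>y z. t x y z) v) w"
  using free_extend_tensor3_class[OF assms vsA coassoc[unfolded comul_left_def comul_right_def]]
  by (simp add: tensor_lift_def case_prod_unfold free_extend_formal[OF vsA]
      module_hom_free_extend_distrib[OF module_hom_free_extend[OF vsA]])

lemma bilinear_mult: "bilinear_map sA sA sA (*)" "bilinear_map sH sH sH (*)"
  by (auto simp: bilinear_map_def Vector_Spaces.linear_iff vsA vsH distrib_left distrib_right
      A.scale_mult_left A.scale_mult_right scale_mult_left scale_mult_right)

lemma convolution_eq: "convolution sA \<Delta> f g = (\<lambda>x. D (\<lambda>u v. f u * g v) x)"
  by (rule ext)
    (simp add: convolution_def mult_map_def tensor_lift_tensor_map[OF bilinear_mult(1) vsA])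

lemma D_antipode_left: "lin f \<Longrightarrow> D (\<lambda>u v. f (S u * v)) x = sA (\<epsilon> x) (f 1)"
  using linear_tensor_lift_distrib[of sH sA f "\<lambda>u v. S u * v" "\<Delta> x"] antipode_left[of x]
  by (simp add: mult_map_def tensor_lift_tensor_map[OF bilinear_mult(2) vsH] lin_scale)

lemma D_antipode_right: "lin f \<Longrightarrow> D (\<lambda>u v. f (u * S v)) x = sA (\<epsilon> x) (f 1)"
  using linear_tensor_lift_distrib[of sH sA f "\<lambda>u v. u * S v" "\<Delta> x"] antipode_right[of x]
  by (simp add: mult_map_def tensor_lift_tensor_map[OF bilinear_mult(2) vsH] lin_scale)

text \<open>Since the coproduct of 1 is \<open>1\<close> tensor \<open>1\<close> and its counit is
  1, the left antipode axiom at 1 reads \<open>S 1 * 1 = 1\<close>.\<close>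

lemma antipode_one: "S 1 = 1"
proof -
  have "bilinear_map sH sH sH (\<lambda>u v. S u * v)"
    using antipode_linear
    by (auto simp: bilinear_map_def Vector_Spaces.linear_iff vsH distrib_left distrib_right
      scale_mult_left scale_mult_right)
  from tensor_lift_pure[OF this vsH, of 1 1] antipode_left[of 1] show ?thesis
    by (simp add: mult_map_def tensor_lift_tensor_map[OF bilinear_mult(2) vsH] comul_one counit)
qed

section \<open>Convolution of characters and the antipode\<close>

lemma convolution_assoc:
  assumes f: "lin f" and g: "lin g" and h: "lin h"
  shows "convolution sA \<Delta> (convolution sA \<Delta> f g) h = convolution sA \<Delta> f (convolution sA \<Delta> g h)"
proof
  fix w
  have "D (\<lambda>u z. D (\<lambda>x y. f x * g y * h z) u) w = D (\<lambda>x v. D (\<lambda>y z. f x * g y * h z) v) w"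
    by (intro D_coassoc lin_intros f g h)
  then show "convolution sA \<Delta> (convolution sA \<Delta> f g) h w =
      convolution sA \<Delta> f (convolution sA \<Delta> g h) w"
    by (simp add: convolution_eq D_const_mult D_mult_const mult.assoc)
qed

lemma character:
  assumes "f \<in> alg_hom sH sA"
  shows "lin f" "f 1 = 1" "f (x * y) = f x * f y"
  using assms by (auto simp: alg_hom_def)

lemma convolution_character:
  assumes f: "f \<in> alg_hom sH sA" and g: "g \<in> alg_hom sH sA"
  shows "convolution sA \<Delta> f g \<in> alg_hom sH sA"
proof -
  note lin = character(1)[OF f] character(1)[OF g]
  have b: "bilin (\<lambda>u v. f u * g v)"
    by (intro bilinear_mapI lin_intros lin)
  show ?thesis
    unfolding alg_hom_def convolution_eq
  proof (safe intro!: lin_intros lin)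
    show "D (\<lambda>u v. f u * g v) 1 = 1"
      by (simp add: D_one[OF b] character[OF f] character[OF g])
    \<comment> \<open>Expanding the coproduct of \<open>x * y\<close> gives terms
      \<open>f (u * u') * g (v * v')\<close>; commutativity of the target regroups them into the
      product of two sums.\<close>
    show "D (\<lambda>u v. f u * g v) (x * y) = D (\<lambda>u v. f u * g v) x * D (\<lambda>u v. f u * g v) y" for x y
      unfolding D_mult[OF b] D_mult_const
      by (simp add: D_const_mult character[OF f] character[OF g] mult_ac)
  qed
qed

lemma unit_character: "(\<lambda>x. sA (\<epsilon> x) 1) \<in> alg_hom sH sA"
  by (simp add: alg_hom_def lin_counit counit scale_one_mult mult.commute)

lemma convolution_unit_left: "lin f \<Longrightarrow> convolution sA \<Delta> (\<lambda>x. sA (\<epsilon> x) 1) f = f"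
  by (simp add: convolution_eq scale_one_mult D_counit_left)

text \<open>Multiplicativity merges \<open>f (S u) * f v\<close> into \<open>f (S u * v)\<close>, to
  which the antipode axiom applies; then \<open>f 1 = 1\<close>.\<close>

lemma convolution_antipode_left:
  assumes f: "f \<in> alg_hom sH sA"
  shows "convolution sA \<Delta> (\<lambda>x. f (S x)) f = (\<lambda>x. sA (\<epsilon> x) 1)"
  using D_antipode_left[OF character(1)[OF f]] by (simp add: convolution_eq character[OF f])

lemma convolution_antipode_right:
  assumes f: "f \<in> alg_hom sH sA"
  shows "convolution sA \<Delta> f (\<lambda>x. f (S x)) = (\<lambda>x. sA (\<epsilon> x) 1)"
  using D_antipode_right[OF character(1)[OF f]] by (simp add: convolution_eq character[OF f])

text \<open>
  Both \<open>g (x * y)\<close> and \<open>g x * g y\<close>, for \<open>g = f \<circ> S\<close>, are convolution inverses of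
  \<open>f (x * y) = f x * f y\<close> as functions of two variables, so they agree.
\<close>

lemma antipode_character:
  assumes f: "f \<in> alg_hom sH sA"
  shows "(\<lambda>x. f (S x)) \<in> alg_hom sH sA"
proof -
  define g where "g = (\<lambda>x. f (S x))"
  note lf = character(1)[OF f]
  have lg: "lin g" unfolding g_def by (rule lin_antipode[OF lf])
  note fg = lf lg lin_arg_mult[OF lg] lin_mult_arg[OF lg]
  note lfg = fg lin_arg_mult[OF lf] lin_mult_arg[OF lf]
  have gf: "D (\<lambda>u v. g u * f v) x = sA (\<epsilon> x) 1" for x
    using convolution_antipode_left[OF f] by (simp add: convolution_eq g_def fun_eq_iff)
  have fg': "D (\<lambda>u v. f u * g v) x = sA (\<epsilon> x) 1" for x
    using convolution_antipode_right[OF f] by (simp add: convolution_eq g_def fun_eq_iff)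
  have "g (x * y) = g x * g y" for x y
  proof -
    \<comment> \<open>The summand after two unit insertions: \<open>x\<close> is split into
      \<open>x1, a, b\<close> and \<open>y\<close> into \<open>y1, c, d\<close>.\<close>
    let ?t = "\<lambda>x1 y1 a b c d. g (x1 * y1) * f (a * c) * (g b * g d)"
    have "g (x * y) = D (\<lambda>x1 x2. sA (\<epsilon> x2) (g (x1 * y))) x"
      by (rule D_counit_right[symmetric]) (rule lfg)
    also have "\<dots> = D (\<lambda>x1 x2. sA (\<epsilon> x2) (D (\<lambda>y1 y2. sA (\<epsilon> y2) (g (x1 * y1))) y)) x"
      by (subst D_counit_right) (simp_all add: lfg)
    also have "\<dots> = D (\<lambda>x1 x2. D (\<lambda>y1 y2. g (x1 * y1) * (sA (\<epsilon> x2) 1 * sA (\<epsilon> y2) 1)) y) x"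
      by (simp add: D_const_mult scale_one_mult(1)[symmetric, of _ "D _ _"])
        (simp add: A.scale_mult_left A.scale_mult_right)
    \<comment> \<open>Both units are expanded by \<open>fg'\<close> into sums of \<open>f\<close>
      times \<open>g\<close>, and \<open>f a * f c\<close> is merged into
      \<open>f (a * c)\<close>.\<close>
    also have "\<dots> = D (\<lambda>x1 x2. D (\<lambda>y1 y2. D (\<lambda>a b. D (\<lambda>c d. ?t x1 y1 a b c d) y2) x2) y) x"
      unfolding fg'[symmetric] D_mult_const by (simp add: D_const_mult character[OF f] mult_ac)
    \<comment> \<open>The swap makes the two sums over \<open>y\<close> adjacent, so that
      coassociativity can pair \<open>c\<close> with \<open>y1\<close>; afterwards \<open>a\<close>
      is paired with \<open>x1\<close>.\<close>
    also have "\<dots> = D (\<lambda>x1 x2. D (\<lambda>a b. D (\<lambda>y1 y2. D (\<lambda>c d. ?t x1 y1 a b c d) y2) y) x2) x"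
      by (subst tensor_lift_swap[OF vsA]) (rule refl)
    also have "\<dots> = D (\<lambda>x1 x2. D (\<lambda>a b. D (\<lambda>y' d. D (\<lambda>y1 c. ?t x1 y1 a b c d) y') y) x2) x"
      by (subst D_coassoc) (intro lin_intros lfg refl)+
    also have "\<dots> = D (\<lambda>x' b. D (\<lambda>x1 a. D (\<lambda>y' d. D (\<lambda>y1 c. ?t x1 y1 a b c d) y') y) x') x"
      by (rule D_coassoc[symmetric]) (intro lin_intros lfg)+
    also have "\<dots> = D (\<lambda>x' b. D (\<lambda>y' d. D (\<lambda>x1 a. D (\<lambda>y1 c. ?t x1 y1 a b c d) y') x') y) x"
      by (subst tensor_lift_swap[OF vsA]) (rule refl)
    \<comment> \<open>The sums over \<open>x1, a, y1, c\<close> run over the coproduct of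
      \<open>x' * y'\<close>, so they evaluate the convolution of \<open>g\<close> and
      \<open>f\<close> there.\<close>
    also have "\<dots> = D (\<lambda>x' b. D (\<lambda>y' d. D (\<lambda>u v. g u * f v) (x' * y') * (g b * g d)) y) x"
      by (subst D_mult) (auto intro!: bilinear_mapI lin_intros fg simp: D_mult_const)
    \<comment> \<open>By \<open>gf\<close> the inner sum is the scalar
      \<open>\<epsilon> (x' * y') = \<epsilon> x' * \<epsilon> y'\<close>, so the double sum
      factors.\<close>
    also have "\<dots> = D (\<lambda>x' b. sA (\<epsilon> x') (g b)) x * D (\<lambda>y' d. sA (\<epsilon> y') (g d)) y"
      unfolding gf D_mult_const
      by (simp add: D_const_mult counit A.scale_mult_left A.scale_mult_right mult.commute)
    also have "\<dots> = g x * g y"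
      by (simp add: D_counit_left[OF lg])
    finally show ?thesis .
  qed
  then show ?thesis
    using lg by (simp add: alg_hom_def g_def antipode_one character[OF f])
qed

text \<open>The unit is \<open>\<epsilon>\<close> followed by the unit map of the target, and
  \<open>f \<circ> S\<close> is the inverse of \<open>f\<close>; \<open>groupI\<close> asks for a
  left unit and left inverses.\<close>

lemma group_characters: "group (character_group sH \<Delta> \<epsilon> sA)"
proof (rule groupI)
  fix f assume "f \<in> carrier (character_group sH \<Delta> \<epsilon> sA)"
  then show "\<exists>g\<in>carrier (character_group sH \<Delta> \<epsilon> sA).
      g \<otimes>\<^bsub>character_group sH \<Delta> \<epsilon> sA\<^esub> f = \<one>\<^bsub>character_group sH \<Delta> \<epsilon> sA\<^esub>"
    by (auto simp: character_group_def antipode_character convolution_antipode_left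
        intro!: bexI[of _ "\<lambda>x. f (S x)"])
qed (simp_all add: character_group_def convolution_character unit_character convolution_assoc
    convolution_unit_left character)


section \<open>Characters on a right coideal\<close>

text \<open>The coproduct of \<open>w\<close> is \<open>1\<close> tensor \<open>w\<close> plus
  \<open>w\<close> tensor \<open>1\<close> plus the class of \<open>p\<close>. One \<open>p\<close>
  serves all bilinear maps, so two of them can be compared term by term.\<close>

lemma D_right_coideal:
  assumes "reduced_comul sH \<Delta> w \<in> tensors_on sH sH (N \<times> UNIV)"
  obtains p where "Poly_Mapping.keys p \<subseteq> N \<times> UNIV"
    "\<And>b. bilin b \<Longrightarrow> D b w = b 1 w + b w 1 + free_extend sA (\<lambda>(x, y). b x y) p"
proof -
  from assms obtain p where p: "Poly_Mapping.keys p \<subseteq> N \<times> UNIV"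
    and eq: "reduced_comul sH \<Delta> w = tensor_class sH sH p"
    by (auto simp: tensors_on_def)
  have "D b w = b 1 w + b w 1 + free_extend sA (\<lambda>(x, y). b x y) p" if b: "bilin b" for b
    using arg_cong[OF eq, of "tensor_lift sA b"]
    by (simp add: reduced_comul_def tensor_lift_diff[OF b vsA] tensor_lift_pure[OF b vsA]
        tensor_lift_bilinear[OF b vsA] algebra_simps)
  with p that show thesis by blast
qed

lemma convolution_cong_right_coideal:
  assumes N: "\<And>w. w \<in> N \<Longrightarrow> reduced_comul sH \<Delta> w \<in> tensors_on sH sH (N \<times> UNIV)"
    and f: "f \<in> alg_hom sH sA" "f' \<in> alg_hom sH sA" and eq: "\<And>w. w \<in> N \<Longrightarrow> f w = f' w"
    and g: "g \<in> alg_hom sH sA" and w: "w \<in> N"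
  shows "convolution sA \<Delta> f g w = convolution sA \<Delta> f' g w"
proof -
  obtain p where p: "Poly_Mapping.keys p \<subseteq> N \<times> UNIV"
    "\<And>b. bilin b \<Longrightarrow> D b w = b 1 w + b w 1 + free_extend sA (\<lambda>(x, y). b x y) p"
    using D_right_coideal[OF N[OF w]] by blast
  \<comment> \<open>Only first components of keys of \<open>p\<close> reach \<open>f\<close> and
    \<open>f'\<close>, and these lie in \<open>N\<close>.\<close>
  have "free_extend sA (\<lambda>(x, y). f x * g y) p = free_extend sA (\<lambda>(x, y). f' x * g y) p"
    using p(1) by (intro free_extend_cong) (auto simp: eq)
  moreover have "bilin (\<lambda>u v. f u * g v)" "bilin (\<lambda>u v. f' u * g v)"
    by (intro bilinear_mapI lin_intros character(1) f g)+
  \<comment> \<open>The other two terms are \<open>g w\<close>, as characters send 1 to 1, and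
    \<open>f w = f' w\<close>.\<close>
  ultimately show ?thesis
    by (simp add: convolution_eq p(2) character(2)[OF f(1)] character(2)[OF f(2)] eq[OF w])
qed

end

section \<open>Left translation by a subgroup\<close>

text \<open>By \<open>closed\<close>, left translation acts on \<open>X\<close>; \<open>quot\<close>
  yields the element joining two given points, and cancellation gives freeness. Restricting to
  \<open>X\<close> makes \<open>act t\<close> extensional, as \<open>Bij X\<close> demands.\<close>

lemma (in group) transitive_free_left_translation:
  assumes T: "subgroup T G" and X: "X \<subseteq> carrier G"
    and closed: "\<And>t x. t \<in> T \<Longrightarrow> x \<in> X \<Longrightarrow> t \<otimes> x \<in> X"
    and quot: "\<And>x y. x \<in> X \<Longrightarrow> y \<in> X \<Longrightarrow> y \<otimes> inv x \<in> T"
  defines "act \<equiv> \<lambda>t. \<lambda>x\<in>X. t \<otimes> x"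
  shows "transitive_action (G\<lparr>carrier := T\<rparr>) X act"
    and "x \<in> X \<Longrightarrow> stabilizer (G\<lparr>carrier := T\<rparr>) act x = {\<one>}"
proof -
  have carr: "t \<in> carrier G" if "t \<in> T" for t
    using that subgroup.subset[OF T] by auto
  have carr': "x \<in> carrier G" if "x \<in> X" for x
    using that X by auto
  have bij: "act t \<in> Bij X" if t: "t \<in> T" for t
  proof -
    \<comment> \<open>Translation by \<open>inv t\<close> also preserves \<open>X\<close>, because
      \<open>T\<close> is closed under inverses.\<close>
    have "bij_betw (\<lambda>x. t \<otimes> x) X X"
      by (rule bij_betw_byWitness[where f' = "\<lambda>x. inv t \<otimes> x"])
        (auto simp: carr carr' t closed subgroup.m_inv_closed[OF T] m_assoc[symmetric])
    then show ?thesis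
      by (auto simp: Bij_def act_def cong: bij_betw_cong)
  qed
  have "act \<in> hom (G\<lparr>carrier := T\<rparr>) (BijGroup X)"
  proof (rule homI)
    fix s t assume "s \<in> carrier (G\<lparr>carrier := T\<rparr>)" "t \<in> carrier (G\<lparr>carrier := T\<rparr>)"
    then have st: "s \<in> T" "t \<in> T" by simp_all
    have "act (s \<otimes> t) = compose X (act s) (act t)"
      by (auto simp: act_def compose_def restrict_def fun_eq_iff closed st carr carr' m_assoc)
    then show "act (s \<otimes>\<^bsub>G\<lparr>carrier := T\<rparr>\<^esub> t) = act s \<otimes>\<^bsub>BijGroup X\<^esub> act t"
      by (simp add: BijGroup_def bij st)
  qed (simp add: BijGroup_def bij)
  then have "group_hom (G\<lparr>carrier := T\<rparr>) (BijGroup X) act"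
    by (simp add: group_hom_def group_hom_axioms_def group_BijGroup
        subgroup.subgroup_is_group[OF T is_group])
  moreover have "\<exists>t\<in>T. act t x = y" if "x \<in> X" "y \<in> X" for x y
    using that by (intro bexI[of _ "y \<otimes> inv x"]) (simp_all add: act_def quot carr' m_assoc)
  ultimately show "transitive_action (G\<lparr>carrier := T\<rparr>) X act"
    by (simp add: transitive_action_def transitive_action_axioms_def group_action_def)
  show "stabilizer (G\<lparr>carrier := T\<rparr>) act x = {\<one>}" if "x \<in> X"
    using that by (auto simp: stabilizer_def act_def carr carr' subgroup.one_closed[OF T])
qed

section \<open>Characters with prescribed values on \<open>N\<close>\<close>

theorem theorem3p2:
  fixes sH :: "'k::field_char_0 \<Rightarrow> 'h::{ring, monoid_mult} \<Rightarrow> 'h"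
    and \<Delta> :: "'h \<Rightarrow> ('k, 'h, 'h) tensor"
    and \<epsilon> :: "'h \<Rightarrow> 'k"
    and S :: "'h \<Rightarrow> 'h"
    and F :: "nat \<Rightarrow> 'h set"
    and N :: "'h set"
    and sA :: "'k \<Rightarrow> 'a::{comm_ring, monoid_mult} \<Rightarrow> 'a"
    and \<zeta> :: "'h \<Rightarrow> 'a"
  defines "G \<equiv> character_group sH \<Delta> \<epsilon> sA"
    and "T \<equiv> vanishing_characters sH sA N"
    and "X \<equiv> extending_characters sH sA N \<zeta>"
  defines "G\<^sub>T \<equiv> G\<lparr>carrier := T\<rparr>"
    and "act \<equiv> (\<lambda>\<phi>. \<lambda>\<alpha>\<in>X. convolution sA \<Delta> \<phi> \<alpha>)"
  assumes H: "connected_filtered_hopf_algebra sH \<Delta> \<epsilon> S F"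
    and A: "k_algebra sA"
    and N_subspace: "module.subspace sH N"
    and N_counit: "\<And>w. w \<in> N \<Longrightarrow> \<epsilon> w = 0"
    and N_comul: "\<And>w. w \<in> N \<Longrightarrow> reduced_comul sH \<Delta> w \<in> tensors_on sH sH (N \<times> UNIV)"
    and zeta_add: "\<And>v w. v \<in> N \<Longrightarrow> w \<in> N \<Longrightarrow> \<zeta> (v + w) = \<zeta> v + \<zeta> w"
    and zeta_scale: "\<And>c v. v \<in> N \<Longrightarrow> \<zeta> (sH c v) = sA c (\<zeta> v)"
    and zeta_mult: "\<And>v w. v \<in> N \<Longrightarrow> w \<in> N \<Longrightarrow> v * w \<in> N \<Longrightarrow> \<zeta> (v * w) = \<zeta> v * \<zeta> w"
  shows "group G \<and> subgroup T G
    \<and> transitive_action G\<^sub>T X act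
    \<and> (\<forall>\<alpha>\<in>X. stabilizer G\<^sub>T act \<alpha> = {\<one>\<^bsub>G\<^sub>T\<^esub>})"
proof -
  interpret connected_filtered_hopf_algebra sH \<Delta> \<epsilon> S F by (rule H)
  interpret A: k_algebra sA by (rule A)
  interpret hopf_characters sH \<Delta> \<epsilon> S sA ..
  have G: "group G" unfolding G_def by (rule group_characters)
  interpret G: group G by (rule G)
  have G_simps: "carrier G = alg_hom sH sA" "\<And>f g. f \<otimes>\<^bsub>G\<^esub> g = convolution sA \<Delta> f g"
    "\<one>\<^bsub>G\<^esub> = (\<lambda>x. sA (\<epsilon> x) 1)"
    by (simp_all add: G_def character_group_def)
  have cong: "(f \<otimes>\<^bsub>G\<^esub> g) w = (f' \<otimes>\<^bsub>G\<^esub> g) w"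
    if "f \<in> carrier G" "f' \<in> carrier G" "g \<in> carrier G" "\<And>w. w \<in> N \<Longrightarrow> f w = f' w" "w \<in> N"
    for f f' g w
    using that unfolding G_simps by (intro convolution_cong_right_coideal[where N = N] N_comul)
  have one: "\<one>\<^bsub>G\<^esub> w = 0" if "w \<in> N" for w
    using that by (simp add: G_simps N_counit)
  \<comment> \<open>Since the counit kills \<open>N\<close>, vanishing on \<open>N\<close> means
    agreeing there with the unit of \<open>G\<close>; membership in \<open>T\<close> thus fits the
    form of \<open>cong\<close>.\<close>
  have T_iff: "\<phi> \<in> T \<longleftrightarrow> \<phi> \<in> carrier G \<and> (\<forall>w\<in>N. \<phi> w = \<one>\<^bsub>G\<^esub> w)" for \<phi>
    by (auto simp: T_def vanishing_characters_def G_simps(1) one)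
  have X_iff: "\<alpha> \<in> X \<longleftrightarrow> \<alpha> \<in> carrier G \<and> (\<forall>w\<in>N. \<alpha> w = \<zeta> w)" for \<alpha>
    by (auto simp: X_def extending_characters_def G_simps(1))
  have T_mult: "(\<phi> \<otimes>\<^bsub>G\<^esub> \<alpha>) w = \<alpha> w" if "\<phi> \<in> T" "\<alpha> \<in> carrier G" "w \<in> N" for \<phi> \<alpha> w
    using cong[of \<phi> "\<one>\<^bsub>G\<^esub>" \<alpha> w] that by (simp add: T_iff)
  \<comment> \<open>Here \<open>cong\<close> replaces \<open>f\<close> by \<open>g\<close>, leaving
    \<open>g\<close> times its inverse. With \<open>f\<close> the unit this gives inverses in
    \<open>T\<close>; with two elements of \<open>X\<close> it gives transitivity.\<close>
  have quot: "(f \<otimes>\<^bsub>G\<^esub> inv\<^bsub>G\<^esub> g) w = \<one>\<^bsub>G\<^esub> w"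
    if "f \<in> carrier G" "g \<in> carrier G" "\<And>w. w \<in> N \<Longrightarrow> f w = g w" "w \<in> N" for f g w
    using cong[of f g "inv\<^bsub>G\<^esub> g" w] that by simp
  have T: "subgroup T G"
  proof (rule G.subgroupI)
    show "inv\<^bsub>G\<^esub> \<phi> \<in> T" if "\<phi> \<in> T" for \<phi>
      using that quot[of "\<one>\<^bsub>G\<^esub>" \<phi>] by (simp add: T_iff)
    show "\<phi> \<otimes>\<^bsub>G\<^esub> \<psi> \<in> T" if "\<phi> \<in> T" "\<psi> \<in> T" for \<phi> \<psi>
      using that T_mult[of \<phi> \<psi>] by (simp add: T_iff)
    show "T \<noteq> {}"
      using T_iff[of "\<one>\<^bsub>G\<^esub>"] by auto
  qed (auto simp: T_iff)
  have act: "act = (\<lambda>\<phi>. \<lambda>\<alpha>\<in>X. \<phi> \<otimes>\<^bsub>G\<^esub> \<alpha>)"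
    by (simp add: act_def G_simps)
  \<comment> \<open>On \<open>N\<close> the product agrees with \<open>\<alpha>\<close>, hence with
    \<open>\<zeta>\<close>.\<close>
  have closed: "\<phi> \<otimes>\<^bsub>G\<^esub> \<alpha> \<in> X" if "\<phi> \<in> T" "\<alpha> \<in> X" for \<phi> \<alpha>
    using that T_mult[of \<phi> \<alpha>] by (simp add: X_iff T_iff)
  have trans: "\<beta> \<otimes>\<^bsub>G\<^esub> inv\<^bsub>G\<^esub> \<alpha> \<in> T" if "\<alpha> \<in> X" "\<beta> \<in> X" for \<alpha> \<beta>
    using that quot[of \<beta> \<alpha>] by (simp add: X_iff T_iff)
  have X: "X \<subseteq> carrier G" by (auto simp: X_iff)
  show ?thesis
    using G T G.transitive_free_left_translation[OF T X closed trans]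
    by (simp add: act G\<^sub>T_def)
qed

end
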